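(* Let $m\ge 1$ and $q\in[0,1)$. Let $H_1,\dots,H_m$ be null hypotheses (each with a fixed truth status) with independent $p$-values $p_1,\dots,p_m\in[0,1]$, and suppose that $p_i\sim\mathrm{Uniform}(0,1)$ whenever $H_i$ is true. Let $\mathcal R_2=\{i: p_i\le p_{(R_2)}\}$ be the rejection set of the two-stage support line (TSSL) procedure with tuning parameter $q$. Then $$\mathrm{bFDR}(\mathcal R_2)=\mathbb P\big(H_{(R_2)}\text{ is true},\ R_2>0\big)\le \frac{q}{1-q}.$$
   Context: Order statistics: $p_{(1)}\le\dots\le p_{(m)}$ are the sorted $p$-values, $p_{(0)}:=0$; $H_{(1)},\dots,H_{(m)}$ are the null hypotheses ordered correspondingly (so $H_{(k)}$ is the hypothesis whose $p$-value is $p_{(k)}$), and $H_{(0)}$ is false by definition. Boundary FDR: for a procedure that makes $R$ rejections, namely $\mathcal R=\{i:p_i\le p_{(R)}\}$, $\mathrm{bFDR}(\mathcal R):=\mathbb P(H_{(R)}\text{ is true},\ R>0)$, i.e. the probability that the rejected hypothesis with the largest $p$-value is a true null. TSSL procedure with tuning parameter $q$: Stage 1: compute $R_1:=\operatorname{argmax}_{k=0,\dots,m}\{qk/m-p_{(k)}\}$. If $R_1=0$, stop and reject nothing ($R_2:=0$). If $R_1=m$, reject all $m$ hypotheses and stop ($R_2:=m$). Otherwise go to Stage 2. Stage 2: compute $R_2:=\operatorname{argmax}_{k=0,\dots,m}\{qk/(m-R_1)-p_{(k)}\}$ and reject $H_{(1)},\dots,H_{(R_2)}$. *)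

theory Defs
  imports "HOL-Probability.Probability"
begin

text \<open>The hypotheses are indexed by \<open>{1..m}\<close>; a realisation of the p-values is a function
  \<open>x\<close> of type \<open>nat \<Rightarrow> real\<close> of which only the values on \<open>{1..m}\<close> matter.\<close>

text \<open>For \<open>1 \<le> k \<le> m\<close> this is the index \<open>i\<close> with \<open>H_(k) = H_i\<close>. Tied p-values are ordered by
  index, since \<open>sort_key\<close> is stable; a true null is almost surely not tied with any other p-value.\<close>

definition order_index :: "nat \<Rightarrow> (nat \<Rightarrow> real) \<Rightarrow> nat \<Rightarrow> nat" where
  "order_index m x k = sort_key x [1..<Suc m] ! (k - 1)"

definition order_stat :: "nat \<Rightarrow> (nat \<Rightarrow> real) \<Rightarrow> nat \<Rightarrow> real" where
  "order_stat m x k = (if k = 0 then 0 else x (order_index m x k))"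

text \<open>\<open>H i\<close> says that the \<open>i\<close>-th null hypothesis is true; \<open>H_(0)\<close> is false by definition.\<close>

definition ordered_null :: "nat \<Rightarrow> (nat \<Rightarrow> bool) \<Rightarrow> (nat \<Rightarrow> real) \<Rightarrow> nat \<Rightarrow> bool" where
  "ordered_null m H x k \<longleftrightarrow> k \<noteq> 0 \<and> H (order_index m x k)"

text \<open>The argmax over \<open>k = 0, \<dots>, m\<close> of \<open>q k / n - p_(k)\<close>. Several maximisers are possible because
  the p-values of false nulls are arbitrary; the largest one is taken. With \<open>q \<ge> 0\<close> this guarantees
  that exactly \<open>R\<close> of the p-values are \<open>\<le> p_(R)\<close>, also for \<open>R = 0\<close>.\<close>

definition support_line :: "nat \<Rightarrow> real \<Rightarrow> nat \<Rightarrow> (nat \<Rightarrow> real) \<Rightarrow> nat" where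
  "support_line m q n x =
     Max {k. is_arg_max (\<lambda>k. q * real k / real n - order_stat m x k) (\<lambda>k. k \<le> m) k}"

definition tssl_R1 :: "nat \<Rightarrow> real \<Rightarrow> (nat \<Rightarrow> real) \<Rightarrow> nat" where
  "tssl_R1 m q x = support_line m q m x"

definition tssl_R2 :: "nat \<Rightarrow> real \<Rightarrow> (nat \<Rightarrow> real) \<Rightarrow> nat" where
  "tssl_R2 m q x =
     (if tssl_R1 m q x = 0 then 0
      else if tssl_R1 m q x = m then m
      else support_line m q (m - tssl_R1 m q x) x)"

definition tssl_rejections :: "nat \<Rightarrow> real \<Rightarrow> (nat \<Rightarrow> real) \<Rightarrow> nat set" where
  "tssl_rejections m q x = {i \<in> {1..m}. x i \<le> order_stat m x (tssl_R2 m q x)}"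

text \<open>A procedure maps the p-values to the set of rejected indices; the number of rejections is the
  cardinality of that set.\<close>

definition bFDR ::
  "'a measure \<Rightarrow> nat \<Rightarrow> (nat \<Rightarrow> bool) \<Rightarrow> (nat \<Rightarrow> 'a \<Rightarrow> real) \<Rightarrow> ((nat \<Rightarrow> real) \<Rightarrow> nat set) \<Rightarrow> real" where
  "bFDR M m H p \<R> =
     measure M {\<omega> \<in> space M. ordered_null m H (\<lambda>i. p i \<omega>) (card (\<R> (\<lambda>i. p i \<omega>)))
                          \<and> card (\<R> (\<lambda>i. p i \<omega>)) > 0}"

end

theory Submission
  imports Defs
begin

text \<open>Let \<open>N(s)\<close> be the number of p-values that are at most \<open>s\<close>. The support line of slope
  \<open>a\<close> rejects up to the largest maximiser \<open>T\<close> of \<open>a * N(s) - s\<close> over \<open>s \<ge> 0\<close>.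
  Fix a true null \<open>i\<close> and let \<open>r\<close> be the number of first-stage rejections when \<open>p_i\<close> is replaced
  by a value too large to be rejected; \<open>r\<close> does not depend on \<open>p_i\<close>. If \<open>i\<close> is the boundary
  rejection of the second stage, then either \<open>i\<close> is not rejected in the first stage and \<open>R1 = r\<close>,
  or \<open>i\<close> is the boundary rejection for both slopes \<open>q / m\<close> and \<open>q / (m - R1)\<close>, with
  \<open>r < R1\<close>. In both cases \<open>i\<close> is the boundary rejection for the slope \<open>q / (m - r)\<close>, which is
  deterministic given the other p-values, so that this has conditional probability at most
  \<open>q / (m - r)\<close>. The first-stage threshold is at most \<open>q\<close>, so \<open>m - r\<close> is at least one plus the
  number of other p-values exceeding \<open>q\<close>. Since \<open>p_i > q\<close> has probability \<open>1 - q\<close> independently of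
  those, \<open>1 - q\<close> times the bound for \<open>i\<close> is at most \<open>q\<close> times the expected share of \<open>i\<close> among
  all p-values exceeding \<open>q\<close>, and these shares sum to at most one.\<close>

section \<open>Counting function and order statistics\<close>

definition count_le :: "nat \<Rightarrow> (nat \<Rightarrow> real) \<Rightarrow> real \<Rightarrow> nat" where
  "count_le m x s = card {j \<in> {1..m}. x j \<le> s}"

lemma count_le_le: "count_le m x s \<le> m"
  unfolding count_le_def by (rule order.trans[OF card_mono[of "{1..m}"]]) auto

lemma count_le_mono: "s \<le> t \<Longrightarrow> count_le m x s \<le> count_le m x t"
  unfolding count_le_def by (rule card_mono) auto

lemma count_le_upd:
  assumes "i \<in> {1..m}"
  shows "count_le m (x(i := t)) s = card {j \<in> {1..m} - {i}. x j \<le> s} + (if t \<le> s then 1 else 0)"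
proof -
  have "{j \<in> {1..m}. (x(i := t)) j \<le> s} =
      {j \<in> {1..m} - {i}. x j \<le> s} \<union> (if t \<le> s then {i} else {})"
    using assms by auto
  moreover have "card ({j \<in> {1..m} - {i}. x j \<le> s} \<union> (if t \<le> s then {i} else {})) =
      card {j \<in> {1..m} - {i}. x j \<le> s} + card (if t \<le> s then {i} else {})"
    by (rule card_Un_disjoint) auto
  ultimately show ?thesis
    by (simp add: count_le_def)
qed

text \<open>In a sorted list the entries that are at most \<open>s\<close> form an initial
  segment.\<close>

lemma sorted_nth_le_iff:
  assumes "sorted xs" and "k < length xs"
  shows "xs ! k \<le> s \<longleftrightarrow> k < length (filter (\<lambda>y. y \<le> s) xs)"
  using assms
proof (induction xs arbitrary: k)
  case Nil
  then show ?case by simp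
next
  case (Cons a xs)
  show ?case
  proof (cases "a \<le> s")
    case True
    then show ?thesis using Cons by (cases k) auto
  next
    case False
    then have "filter (\<lambda>y. y \<le> s) (a # xs) = []"
      using Cons.prems(1) by (auto simp: filter_empty_conv)
    moreover have "a \<le> (a # xs) ! k"
      using Cons.prems by (cases k) auto
    ultimately show ?thesis using False by simp
  qed
qed

text \<open>This trades sorting for counting. The index \<open>k = 0\<close> is excluded because its
  order statistic is 0 by convention, while every count is at least 0.\<close>

lemma order_stat_le_iff:
  assumes "1 \<le> k" and "k \<le> m"
  shows "order_stat m x k \<le> s \<longleftrightarrow> k \<le> count_le m x s"
proof -
  let ?L = "sort_key x [1..<Suc m]"
  have "order_stat m x k = map x ?L ! (k - 1)"
    using assms by (simp add: order_stat_def order_index_def)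
  also have "\<dots> \<le> s \<longleftrightarrow> k - 1 < length (filter (\<lambda>y. y \<le> s) (map x ?L))"
    using assms by (intro sorted_nth_le_iff) auto
  also have "length (filter (\<lambda>y. y \<le> s) (map x ?L)) = length (filter (\<lambda>j. x j \<le> s) ?L)"
    by (simp add: filter_map o_def)
  also have "\<dots> = card (set (filter (\<lambda>j. x j \<le> s) ?L))"
    by (rule distinct_card[symmetric]) auto
  also have "\<dots> = count_le m x s"
    unfolding count_le_def by (rule arg_cong[where f = card]) auto
  finally show ?thesis using assms by auto
qed

lemma order_stat_cong:
  assumes "\<And>j. j \<in> {1..m} \<Longrightarrow> x j = y j" and "k \<le> m"
  shows "order_stat m x k = order_stat m y k"
proof (cases "k = 0")
  case False
  have "count_le m x s = count_le m y s" for s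
    unfolding count_le_def by (rule arg_cong[where f = card]) (use assms(1) in auto)
  then have "order_stat m x k \<le> s \<longleftrightarrow> order_stat m y k \<le> s" for s
    using False assms(2) by (simp add: order_stat_le_iff)
  then show ?thesis by (meson order.antisym order.refl)
qed (simp add: order_stat_def)

lemma order_index_in:
  assumes "1 \<le> k" and "k \<le> m"
  shows "order_index m x k \<in> {1..m}"
proof -
  have "sort_key x [1..<Suc m] ! (k - 1) \<in> set (sort_key x [1..<Suc m])"
    using assms by (intro nth_mem) simp
  then show ?thesis by (simp add: order_index_def atLeastLessThanSuc_atLeastAtMost del: upt_Suc)
qed

lemma order_stat_nonneg:
  assumes "\<And>j. j \<in> {1..m} \<Longrightarrow> 0 \<le> x j" and "k \<le> m"
  shows "0 \<le> order_stat m x k"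
  using assms order_index_in[of k m x] by (cases "k = 0") (auto simp: order_stat_def)

section \<open>The support line as a largest maximiser over indices\<close>

lemma support_line_cong:
  assumes "\<And>j. j \<in> {1..m} \<Longrightarrow> x j = y j"
  shows "support_line m q n x = support_line m q n y"
  unfolding support_line_def is_arg_max_def
  using order_stat_cong[OF assms, where m = m]
  by (intro arg_cong[where f = Max] Collect_cong) auto

lemma support_line_is_arg_max:
  "is_arg_max (\<lambda>k. q * real k / real n - order_stat m x k) (\<lambda>k. k \<le> m) (support_line m q n x)"
  and support_line_greatest:
  "is_arg_max (\<lambda>k. q * real k / real n - order_stat m x k) (\<lambda>k. k \<le> m) k
    \<Longrightarrow> k \<le> support_line m q n x"
proof -
  let ?f = "\<lambda>k. q * real k / real n - order_stat m x k"
  let ?A = "{k. is_arg_max ?f (\<lambda>k. k \<le> m) k}"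
  have fin: "finite ?A"
    by (rule finite_subset[of _ "{..m}"]) (auto simp: is_arg_max_def)
  have "Max (?f ` {..m}) \<in> ?f ` {..m}"
    by (intro Max_in) auto
  then obtain l where "l \<in> {..m}" "Max (?f ` {..m}) = ?f l"
    by (rule imageE)
  then have l: "l \<le> m" "?f l = Max (?f ` {..m})"
    by auto
  have "is_arg_max ?f (\<lambda>k. k \<le> m) l"
    using l by (auto simp: is_arg_max_linorder)
  then have "?A \<noteq> {}" by auto
  from Max_in[OF fin this]
  show "is_arg_max ?f (\<lambda>k. k \<le> m) (support_line m q n x)"
    by (simp add: support_line_def)
  show "k \<le> support_line m q n x" if "is_arg_max ?f (\<lambda>k. k \<le> m) k"
    unfolding support_line_def by (rule Max_ge[OF fin]) (use that in auto)
qed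

lemma support_line_le: "support_line m q n x \<le> m"
  using support_line_is_arg_max[of q n m x] by (auto simp: is_arg_max_def)

lemma support_line_max:
  "k \<le> m \<Longrightarrow> q * real k / real n - order_stat m x k
    \<le> q * real (support_line m q n x) / real n - order_stat m x (support_line m q n x)"
  using support_line_is_arg_max[of q n m x] by (auto simp: is_arg_max_linorder)

lemma support_line_max_strict:
  assumes "k \<le> m" and "support_line m q n x < k"
  shows "q * real k / real n - order_stat m x k
    < q * real (support_line m q n x) / real n - order_stat m x (support_line m q n x)"
proof (rule ccontr)
  assume "\<not> ?thesis"
  then have "is_arg_max (\<lambda>k. q * real k / real n - order_stat m x k) (\<lambda>k. k \<le> m) k"
    using assms(1) support_line_max[of _ m q n x]
    by (auto simp: is_arg_max_linorder not_less intro: order.trans)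
  with support_line_greatest[of q n m x k] assms(2) show False by simp
qed

section \<open>Support points: maximisers over real thresholds\<close>

text \<open>Thresholds instead of indices allow a direct comparison between different slopes and
  between modified p-value vectors. The strict clause singles out the largest maximiser.
  Nonnegativity of \<open>T\<close> is not built in and is assumed separately.\<close>

definition support_point :: "nat \<Rightarrow> real \<Rightarrow> (nat \<Rightarrow> real) \<Rightarrow> real \<Rightarrow> bool" where
  "support_point m a x T \<longleftrightarrow>
     (\<forall>s\<ge>0. a * count_le m x s - s \<le> a * count_le m x T - T \<and>
            (T < s \<longrightarrow> a * count_le m x s - s < a * count_le m x T - T))"

text \<open>If ties at the threshold made the count \<open>c\<close> exceed the index
  \<open>k\<close>, then \<open>p_(c)\<close> would be at most \<open>p_(k)\<close>, and as
  \<open>q\<close> is nonnegative \<open>c\<close> would be a larger maximiser.\<close>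

lemma count_le_support_line:
  assumes "0 \<le> q"
  shows "count_le m x (order_stat m x (support_line m q n x)) = support_line m q n x"
    (is "?c = ?k")
proof (rule antisym)
  show "?k \<le> ?c"
    using order_stat_le_iff[of ?k m x "order_stat m x ?k"] support_line_le[of m q n x]
    by (cases "?k = 0") auto
  show "?c \<le> ?k"
  proof (rule ccontr)
    assume *: "\<not> ?c \<le> ?k"
    have "order_stat m x ?c \<le> order_stat m x ?k"
      using * count_le_le by (subst order_stat_le_iff) auto
    moreover have "q * real ?k / real n \<le> q * real ?c / real n"
      using * assms by (intro divide_right_mono mult_left_mono) auto
    ultimately show False
      using support_line_max_strict[of ?c m q n x] * count_le_le[of m x] by auto
  qed
qed

text \<open>The objective at \<open>s\<close> is at most the one at index
  \<open>c = count_le m x s\<close>, since \<open>p_(c)\<close> is at most \<open>s\<close>. For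
  \<open>s\<close> beyond the threshold, strictness comes from \<open>s\<close> itself if the count
  is unchanged, and otherwise from the choice of the largest index.\<close>

lemma support_point_support_line:
  assumes "0 \<le> q"
  shows "support_point m (q / real n) x (order_stat m x (support_line m q n x))"
proof -
  let ?k = "support_line m q n x"
  let ?T = "order_stat m x ?k"
  {
    fix s :: real
    assume s: "0 \<le> s"
    let ?c = "count_le m x s"
    have le: "order_stat m x ?c \<le> s"
      using s order_stat_le_iff[of ?c m x s] count_le_le[of m x s]
      by (cases "?c = 0") (auto simp: order_stat_def)
    have 1: "q * ?c / n - s \<le> q * ?k / n - ?T"
      using support_line_max[of ?c m q n x, OF count_le_le] le by simp
    have 2: "q * ?c / n - s < q * ?k / n - ?T" if "?T < s"
    proof (cases "?c = ?k")
      case True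
      then show ?thesis using that by simp
    next
      case False
      have "count_le m x ?T \<le> ?c"
        by (rule count_le_mono) (use that in simp)
      then have "?k < ?c"
        using False by (simp add: count_le_support_line[OF assms])
      from support_line_max_strict[of ?c m q n x, OF count_le_le this] le show ?thesis by simp
    qed
    note 1 2
  }
  then show ?thesis
    by (simp add: support_point_def count_le_support_line[OF assms])
qed

text \<open>If \<open>T < S\<close>, optimality of \<open>S\<close> for \<open>a\<close> says that
  the extra counts times \<open>a\<close> pay for \<open>S - T\<close>, while optimality of
  \<open>T\<close> for \<open>b\<close> says that even times \<open>b\<close> they do not.\<close>

lemma support_point_slope_mono:
  assumes "support_point m a x S" and "support_point m b x T" and "a \<le> b" and "0 \<le> S" and "0 \<le> T"
  shows "S \<le> T"
proof (rule ccontr)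
  assume "\<not> S \<le> T"
  then have *: "T < S" by simp
  then have "real (count_le m x T) \<le> real (count_le m x S)"
    using count_le_mono[of T S m x] by simp
  then have "a * (real (count_le m x S) - count_le m x T) \<le> b * (real (count_le m x S) - count_le m x T)"
    using assms(3) by (intro mult_right_mono) auto
  moreover have "a * count_le m x T - T \<le> a * count_le m x S - S"
    using assms(1,5) by (simp add: support_point_def)
  moreover have "b * count_le m x S - S < b * count_le m x T - T"
    using assms(2,4) * by (simp add: support_point_def)
  ultimately show False by (simp add: algebra_simps)
qed

lemma support_point_unique:
  assumes "support_point m a x S" and "support_point m a x T" and "0 \<le> S" and "0 \<le> T"
  shows "S = T"
  using assms support_point_slope_mono[of m a x] by (intro antisym) auto

text \<open>The advantage of \<open>T\<close> over \<open>s\<close> is affine in the slope. If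
  \<open>s\<close> has no larger count, it can only grow from \<open>a\<close> to \<open>c\<close>;
  if \<open>s\<close> has a larger count, it can only grow from \<open>b\<close> down to
  \<open>c\<close>. The second case forces the count at \<open>T\<close> below \<open>m\<close>, so
  \<open>b\<close> may be meaningless when everything is rejected.\<close>

lemma support_point_interpolate:
  assumes a: "support_point m a x T" and "a \<le> c"
    and b: "count_le m x T < m \<Longrightarrow> support_point m b x T \<and> c \<le> b"
  shows "support_point m c x T"
  unfolding support_point_def
proof (intro allI impI)
  fix s :: real
  assume s: "0 \<le> s"
  let ?N = "\<lambda>s. real (count_le m x s)"
  define d where "d = (if ?N s \<le> ?N T then a else b)"
  have d: "support_point m d x T" and le: "(d - c) * (?N T - ?N s) \<le> 0"
    using a b assms(2) count_le_le[of m x s]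
    by (auto simp: d_def not_le intro: mult_nonpos_nonneg mult_nonneg_nonpos)
  have "d * ?N s - s \<le> d * ?N T - T" "T < s \<Longrightarrow> d * ?N s - s < d * ?N T - T"
    using d s by (auto simp: support_point_def)
  with le show "c * ?N s - s \<le> c * ?N T - T \<and> (T < s \<longrightarrow> c * ?N s - s < c * ?N T - T)"
    by (auto simp: algebra_simps)
qed

lemma support_point_order_stat:
  assumes q: "0 \<le> q" and sp: "support_point m (q / real n) x T" and "0 \<le> T"
    and nonneg: "\<And>j. j \<in> {1..m} \<Longrightarrow> 0 \<le> x j"
  shows "order_stat m x (support_line m q n x) = T"
  using support_point_support_line[OF q] sp order_stat_nonneg[OF nonneg support_line_le] \<open>0 \<le> T\<close>
  by (rule support_point_unique)

section \<open>The two-stage procedure and its boundary rejection\<close>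

lemma tssl_R2_le: "tssl_R2 m q x \<le> m"
  by (simp add: tssl_R2_def support_line_le)

lemma card_tssl_rejections:
  assumes "0 \<le> q"
  shows "card (tssl_rejections m q x) = tssl_R2 m q x"
proof -
  have "card (tssl_rejections m q x) = count_le m x (order_stat m x (tssl_R2 m q x))"
    by (simp add: tssl_rejections_def count_le_def)
  \<comment> \<open>In all three branches \<open>tssl_R2\<close> is a value of
    \<open>support_line\<close>: the outcomes 0 and \<open>m\<close> are those of the first
    stage.\<close>
  also have "\<dots> = tssl_R2 m q x"
    using count_le_support_line[OF assms]
    by (metis tssl_R2_def tssl_R1_def)
  finally show ?thesis .
qed

text \<open>The value \<open>2\<close> exceeds \<open>q\<close>, so that hypothesis \<open>i\<close> is never rejected.\<close>

definition loo_support_line :: "nat \<Rightarrow> real \<Rightarrow> nat \<Rightarrow> (nat \<Rightarrow> real) \<Rightarrow> nat" where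
  "loo_support_line m q i x = support_line m q m (x(i := 2))"

text \<open>Phrased by values rather than by \<open>order_index\<close>, hence indifferent to ties;
  only an upper bound on the probability is sought.\<close>

definition boundary_at :: "nat \<Rightarrow> real \<Rightarrow> nat \<Rightarrow> nat \<Rightarrow> (nat \<Rightarrow> real) \<Rightarrow> bool" where
  "boundary_at m q n i x \<longleftrightarrow> order_stat m x (support_line m q n x) = x i"

text \<open>Comparison with the index 0, whose objective is 0.\<close>

lemma order_stat_support_line_le:
  assumes "0 \<le> q"
  shows "order_stat m x (support_line m q m x) \<le> q"
proof -
  have "0 \<le> q * real (support_line m q m x) / real m - order_stat m x (support_line m q m x)"
    using support_line_max[of 0 m q m x] by (simp add: order_stat_def)
  moreover have "q * (real (support_line m q m x) / real m) \<le> q * 1"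
    using assms support_line_le[of m q m x] by (intro mult_left_mono) (auto simp: divide_le_eq_1)
  ultimately show ?thesis by simp
qed

lemma loo_support_line_le:
  assumes "0 \<le> q" and "q < 1" and i: "i \<in> {1..m}"
  shows "loo_support_line m q i x \<le> card {j \<in> {1..m} - {i}. x j \<le> q}"
proof -
  let ?x = "x(i := 2)"
  have "loo_support_line m q i x = count_le m ?x (order_stat m ?x (support_line m q m ?x))"
    by (simp add: loo_support_line_def count_le_support_line[OF assms(1)])
  also have "\<dots> \<le> count_le m ?x q"
    by (intro count_le_mono order_stat_support_line_le assms)
  also have "\<dots> = card {j \<in> {1..m} - {i}. x j \<le> q}"
    using assms by (simp add: count_le_upd)
  finally show ?thesis .
qed

lemma loo_support_line_less:
  assumes "0 \<le> q" and "q < 1" and i: "i \<in> {1..m}"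
  shows "loo_support_line m q i x < m"
proof -
  have "card {j \<in> {1..m} - {i}. x j \<le> q} \<le> card ({1..m} - {i})"
    by (intro card_mono) auto
  with i loo_support_line_le[OF assms, of x] show ?thesis by auto
qed

text \<open>The deterministic core: the second-stage slope, which depends on \<open>x i\<close>, is
  replaced by one that depends on the other p-values only.\<close>

lemma tssl_boundary:
  assumes q: "0 \<le> q" "q < 1" and x: "\<And>j. j \<in> {1..m} \<Longrightarrow> x j \<in> {0..1}"
    and R2: "0 < tssl_R2 m q x" and i: "i = order_index m x (tssl_R2 m q x)"
  shows "boundary_at m q (m - loo_support_line m q i x) i x"
proof -
  have nonneg: "0 \<le> x j" if "j \<in> {1..m}" for j
    using x[OF that] by simp
  have i_in: "i \<in> {1..m}"
    unfolding i using R2 by (intro order_index_in tssl_R2_le) simp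
  let ?x = "x(i := 2)"
  let ?n = "count_le m x" and ?n' = "count_le m ?x"
  have nonneg': "0 \<le> ?x j" if "j \<in> {1..m}" for j
    using nonneg[OF that] by simp
  define T1 where "T1 = order_stat m x (tssl_R1 m q x)"
  define T0 where "T0 = order_stat m ?x (loo_support_line m q i x)"
  define r where "r = loo_support_line m q i x"
  have r_less: "r < m"
    unfolding r_def by (rule loo_support_line_less[OF q i_in])
  have sp1: "support_point m (q / m) x T1"
    unfolding T1_def tssl_R1_def by (rule support_point_support_line[OF q(1)])
  have sp0: "support_point m (q / m) ?x T0"
    unfolding T0_def loo_support_line_def by (rule support_point_support_line[OF q(1)])
  have T1_nonneg: "0 \<le> T1"
    unfolding T1_def tssl_R1_def by (rule order_stat_nonneg[OF nonneg support_line_le])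
  have T0_nonneg: "0 \<le> T0"
    unfolding T0_def loo_support_line_def by (rule order_stat_nonneg[OF nonneg' support_line_le])
  have n1: "?n T1 = tssl_R1 m q x"
    unfolding T1_def tssl_R1_def by (rule count_le_support_line[OF q(1)])
  have n0: "?n' T0 = r"
    unfolding T0_def r_def loo_support_line_def by (rule count_le_support_line[OF q(1)])
  have T0_le: "T0 < 2"
    using order_stat_support_line_le[OF q(1), of m ?x] q(2)
    by (simp add: T0_def loo_support_line_def)
  have xi: "x i = order_stat m x (tssl_R2 m q x)"
    using R2 by (simp add: i order_stat_def)
  have xi_ge: "0 \<le> x i" "x i \<le> 1"
    using x[OF i_in] by auto
  have R1_pos: "tssl_R1 m q x \<noteq> 0"
    using R2 by (intro notI) (simp add: tssl_R2_def)
  have sp2: "support_point m (q / real (m - tssl_R1 m q x)) x (x i)" if "tssl_R1 m q x < m"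
    using that R1_pos support_point_support_line[OF q(1), of m "m - tssl_R1 m q x" x]
    unfolding xi by (simp add: tssl_R2_def)
  have R1_le: "tssl_R1 m q x \<le> m"
    by (simp add: tssl_R1_def support_line_le)
  have split: "?n s = ?n' s + (if x i \<le> s then 1 else 0)" if "s < 2" for s
    using count_le_upd[OF i_in, of x "x i" s] count_le_upd[OF i_in, of x 2 s] that by simp
  \<comment> \<open>The second slope is at least the first, so the threshold cannot
    decrease.\<close>
  have T1_le: "T1 \<le> x i"
  proof (cases "tssl_R1 m q x = m")
    case True
    then show ?thesis using R1_pos xi by (simp add: T1_def tssl_R2_def)
  next
    case False
    have "q / m \<le> q / real (m - tssl_R1 m q x)"
      using False R1_le q by (intro divide_left_mono) auto
    with support_point_slope_mono[OF sp1 sp2 this] False R1_le T1_nonneg xi_ge show ?thesis by auto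
  qed
  have "support_point m (q / real (m - r)) x (x i)"
  proof (cases "T1 = x i")
    case True
    \<comment> \<open>At \<open>T1 = x i\<close> and at any larger \<open>T0 < 2\<close>, restoring
      \<open>x i\<close> adds exactly one to the count, so \<open>x\<close> and \<open>?x\<close>
      would rank the two thresholds oppositely.\<close>
    have "T0 \<le> T1"
    proof (rule ccontr)
      assume *: "\<not> T0 \<le> T1"
      have "q / m * ?n' T1 - T1 \<le> q / m * ?n' T0 - T0"
        using sp0 T1_nonneg by (simp add: support_point_def)
      moreover have "q / m * ?n T0 - T0 < q / m * ?n T1 - T1"
        using sp1 T0_nonneg * by (simp add: support_point_def)
      ultimately show False
        using split[of T1] split[of T0] * True xi_ge T0_le
        by (simp add: distrib_left add_divide_distrib)
    qed
    then have "r \<le> ?n' T1"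
      unfolding n0[symmetric] by (rule count_le_mono)
    \<comment> \<open>Strict because \<open>i\<close> itself is counted at \<open>T1\<close> in
      \<open>x\<close> but not in \<open>?x\<close>.\<close>
    then have "r < tssl_R1 m q x"
      using split[of T1] True xi_ge n1 by simp
    then show ?thesis
      using sp1 sp2 True r_less n1 q R1_le
      by (intro support_point_interpolate[of m "q / m" x "x i" "q / real (m - r)" "q / real (m - tssl_R1 m q x)"])
         (auto intro!: divide_left_mono)
  next
    case False
    with T1_le have *: "T1 < x i" by simp
    \<comment> \<open>Here \<open>i\<close> is not rejected in the first stage: raising its p-value
      keeps the count at \<open>T1\<close> and can only lower the others.\<close>
    have "support_point m (q / m) ?x T1"
      unfolding support_point_def
    proof (intro allI impI)
      fix s :: real
      assume s: "0 \<le> s"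
      have "q / m * ?n' s \<le> q / m * ?n s"
        using q(1) xi_ge count_le_upd[OF i_in, of x "x i" s] count_le_upd[OF i_in, of x 2 s]
        by (intro mult_left_mono) auto
      moreover have "?n' T1 = ?n T1"
        using split[of T1] * xi_ge by simp
      moreover have "q / m * ?n s - s \<le> q / m * ?n T1 - T1"
        "T1 < s \<Longrightarrow> q / m * ?n s - s < q / m * ?n T1 - T1"
        using sp1 s by (auto simp: support_point_def)
      ultimately show "q / m * ?n' s - s \<le> q / m * ?n' T1 - T1 \<and>
          (T1 < s \<longrightarrow> q / m * ?n' s - s < q / m * ?n' T1 - T1)"
        by auto
    qed
    from support_point_unique[OF sp0 this T0_nonneg T1_nonneg] have "T0 = T1" .
    then have "r = tssl_R1 m q x"
      using n0 n1 split[of T1] * xi_ge by simp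
    then show ?thesis using sp2 r_less by simp
  qed
  from support_point_order_stat[OF q(1) this xi_ge(1) nonneg]
  show ?thesis by (simp add: boundary_at_def r_def)
qed

section \<open>A length bound for sets of boundary positions\<close>

text \<open>On the level sets of \<open>G\<close> the map \<open>t \<mapsto> a * G t - t\<close> is an isometry. The
  hypotheses \<open>decr\<close> and \<open>diam\<close> make it injective on \<open>S\<close> with an image of diameter at most \<open>a\<close>.\<close>

lemma emeasure_record_set_le:
  fixes G :: "real \<Rightarrow> nat" and a :: real
  assumes S [measurable]: "S \<in> sets borel" and G [measurable]: "G \<in> measurable borel (count_space UNIV)"
    and bound: "\<And>t. G t \<le> m" and "0 \<le> a"
    and decr: "\<And>s t :: real. s \<in> S \<Longrightarrow> t \<in> S \<Longrightarrow> s < t \<Longrightarrow> a * G t - t < a * G s - s"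
    and diam: "\<And>s t :: real. s \<in> S \<Longrightarrow> t \<in> S \<Longrightarrow> s < t \<Longrightarrow> a * G s - s \<le> a * G t - t + a"
  shows "emeasure lborel S \<le> ennreal a"
proof (cases "S = {}")
  case False
  define f where "f t = a * G t - t" for t :: real
  define V where "V = Sup (f ` S)"
  have close: "f s \<le> f t + a" if "s \<in> S" "t \<in> S" for s t
    using decr[OF that(2,1)] diam[OF that] \<open>0 \<le> a\<close> by (cases s t rule: linorder_cases) (auto simp: f_def)
  obtain t0 where t0: "t0 \<in> S" using False by auto
  have bdd: "bdd_above (f ` S)"
    using close[OF _ t0] by (auto intro!: bdd_aboveI[of _ "f t0 + a"])
  have f_range: "f t \<in> {V - a..V}" if "t \<in> S" for t
  proof -
    have "f t \<le> V"
      unfolding V_def using that bdd by (auto intro: cSup_upper)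
    moreover have "V \<le> f t + a"
      unfolding V_def using t0 close that by (intro cSup_least) auto
    ultimately show ?thesis by simp
  qed
  have inj: "s = t" if "s \<in> S" "t \<in> S" "f s = f t" for s t
    using decr[OF that(1,2)] decr[OF that(2,1)] that(3)
    by (cases s t rule: linorder_cases) (auto simp: f_def)
  define P where "P k = S \<inter> G -` {k}" for k
  \<comment> \<open>\<open>Q k\<close> is the image of \<open>P k\<close> under \<open>f\<close>,
    written as a preimage under the reflection that inverts \<open>f\<close> on this level set; its
    form fits the affine substitution rule.\<close>
  define Q where "Q k = (\<lambda>u. a * real k + - 1 * u) -` P k" for k
  have P [measurable]: "P k \<in> sets borel" for k
  proof -
    have "S \<inter> (G -` {k} \<inter> space borel) \<in> sets borel"
      by (intro sets.Int S measurable_sets[OF G]) auto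
    then show ?thesis by (simp add: P_def)
  qed
  have Q [measurable]: "Q k \<in> sets borel" for k
  proof -
    have "(\<lambda>u. a * real k + - 1 * u) -` P k \<inter> space borel \<in> sets borel"
      by (rule measurable_sets[OF _ P]) measurable
    then show ?thesis by (simp add: Q_def)
  qed
  have Q_D: "a * real k - u \<in> S" "f (a * real k - u) = u" if "u \<in> Q k" for k u
  proof -
    have "a * real k - u \<in> S" and G_eq: "G (a * real k - u) = k"
      using that unfolding Q_def P_def by simp_all
    then show "a * real k - u \<in> S" by simp
    show "f (a * real k - u) = u"
      unfolding f_def G_eq by simp
  qed
  have disj_Q: "disjoint_family_on Q {..m}"
  proof -
    have "j = k" if "u \<in> Q j" "u \<in> Q k" for j k u
    proof -
      have "a * real j - u = a * real k - u"
        by (rule inj[OF Q_D(1)[OF that(1)] Q_D(1)[OF that(2)]])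
          (simp only: Q_D(2)[OF that(1)] Q_D(2)[OF that(2)])
      moreover have "j = G (a * real j - u)" "G (a * real k - u) = k"
        using that unfolding Q_def P_def by simp_all
      ultimately show ?thesis by metis
    qed
    then show ?thesis by (auto simp: disjoint_family_on_def)
  qed
  have eq: "emeasure lborel (P k) = emeasure lborel (Q k)" for k
  proof -
    have "emeasure lborel (P k) = (\<integral>\<^sup>+t. indicator (P k) t \<partial>lborel)"
      by simp
    also have "\<dots> = ennreal \<bar>- 1\<bar> * (\<integral>\<^sup>+u. indicator (P k) (a * real k + - 1 * u) \<partial>lborel)"
      by (rule nn_integral_real_affine) auto
    also have "\<dots> = (\<integral>\<^sup>+u. indicator (Q k) u \<partial>lborel)"
      by (simp add: Q_def indicator_def)
    finally show ?thesis by simp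
  qed
  have "S = (\<Union>k\<le>m. P k)"
    using bound by (auto simp: P_def)
  then have "emeasure lborel S = emeasure lborel (\<Union>k\<le>m. P k)"
    by (rule arg_cong)
  also have "\<dots> = (\<Sum>k\<le>m. emeasure lborel (P k))"
    using P by (intro sum_emeasure[symmetric]) (auto simp: disjoint_family_on_def P_def)
  also have "\<dots> = (\<Sum>k\<le>m. emeasure lborel (Q k))"
    by (simp add: eq)
  also have "\<dots> = emeasure lborel (\<Union>k\<le>m. Q k)"
    using disj_Q by (intro sum_emeasure) auto
  \<comment> \<open>The disjoint images all lie in the range of \<open>f\<close>, hence in an
    interval of length \<open>a\<close>.\<close>
  also have "\<dots> \<le> emeasure lborel {V - a..V}"
  proof (intro emeasure_mono subsetI)
    fix u
    assume "u \<in> (\<Union>k\<le>m. Q k)"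
    then obtain k where "u \<in> Q k" by blast
    from f_range[OF Q_D(1)[OF this]] show "u \<in> {V - a..V}"
      unfolding Q_D(2)[OF \<open>u \<in> Q k\<close>] .
  qed simp
  also have "\<dots> = ennreal a"
    using \<open>0 \<le> a\<close> by simp
  finally show ?thesis .
qed simp

section \<open>Measurability in the vector of p-values\<close>

lemma measurable_count_le [measurable]:
  "(\<lambda>x. count_le m x s) \<in> measurable (PiM {1..m} (\<lambda>_. borel)) (count_space UNIV)"
proof -
  have "(\<lambda>x. \<Sum>j\<in>{1..m}. if x j \<le> s then 1 else 0 :: nat) \<in> measurable (PiM {1..m} (\<lambda>_. borel)) (count_space UNIV)"
    by measurable
  moreover have "count_le m x s = (\<Sum>j\<in>{1..m}. if x j \<le> s then 1 else 0)" for x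
    by (simp add: count_le_def sum.If_cases Int_def)
  ultimately show ?thesis by simp
qed

lemma measurable_order_stat:
  assumes "k \<le> m"
  shows "(\<lambda>x. order_stat m x k) \<in> borel_measurable (PiM {1..m} (\<lambda>_. borel))"
proof (cases "k = 0")
  case False
  have "Measurable.pred (PiM {1..m} (\<lambda>_. borel)) (\<lambda>x. k \<le> count_le m x a)" for a
    by measurable
  with False assms show ?thesis
    by (simp add: borel_measurable_iff_le order_stat_le_iff pred_def)
qed (simp add: order_stat_def)

lemma measurable_support_line [measurable]:
  "support_line m q n \<in> measurable (PiM {1..m} (\<lambda>_. borel)) (count_space UNIV)"
proof -
  have "Measurable.pred (PiM {1..m} (\<lambda>_. borel))
      (\<lambda>x. is_arg_max (\<lambda>k. q * real k / real n - order_stat m x k) (\<lambda>k. k \<le> m) k)" for k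
  proof (cases "k \<le> m")
    case True
    have "Measurable.pred (PiM {1..m} (\<lambda>_. borel))
        (\<lambda>x. q * real l / real n - order_stat m x l \<le> q * real k / real n - order_stat m x k)"
      if "l \<in> {..m}" for l
      unfolding pred_def using that True
      by (intro borel_measurable_le borel_measurable_diff borel_measurable_const measurable_order_stat) auto
    then have "Measurable.pred (PiM {1..m} (\<lambda>_. borel))
       (\<lambda>x. \<forall>l\<in>{..m}. q * real l / real n - order_stat m x l \<le> q * real k / real n - order_stat m x k)"
      by (intro pred_intros_finite) auto
    moreover have "is_arg_max (\<lambda>k. q * real k / real n - order_stat m x k) (\<lambda>k. k \<le> m) k \<longleftrightarrow>
        (\<forall>l\<in>{..m}. q * real l / real n - order_stat m x l \<le> q * real k / real n - order_stat m x k)" for x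
      using True by (auto simp: is_arg_max_linorder)
    ultimately show ?thesis by (simp only:)
  qed (simp add: is_arg_max_def)
  then show ?thesis
    unfolding support_line_def[abs_def] by (rule measurable_Max_nat)
qed

lemma measurable_loo_support_line [measurable]:
  assumes "i \<in> {1..m}"
  shows "loo_support_line m q i \<in> measurable (PiM {1..m} (\<lambda>_. borel)) (count_space UNIV)"
proof -
  have "(\<lambda>x. x(i := 2 :: real)) \<in> measurable (PiM {1..m} (\<lambda>_. borel)) (PiM {1..m} (\<lambda>_. borel))"
    using assms by (intro measurable_fun_upd[where J = "{1..m}"]) auto
  from measurable_compose[OF this measurable_support_line] show ?thesis
    by (simp add: loo_support_line_def[abs_def])
qed

text \<open>The order statistic is taken at a random index, so the event is split over the finitely
  many values of that index.\<close>

lemma pred_boundary_at [measurable]: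
  assumes "i \<in> {1..m}"
  shows "Measurable.pred (PiM {1..m} (\<lambda>_. borel)) (boundary_at m q n i)"
proof -
  have [measurable]: "Measurable.pred (PiM {1..m} (\<lambda>_. borel)) (\<lambda>x. order_stat m x k = x i)"
    if "k \<in> {..m}" for k
    unfolding pred_def using that assms
    by (intro borel_measurable_eq measurable_order_stat measurable_component_singleton) auto
  have "Measurable.pred (PiM {1..m} (\<lambda>_. borel))
      (\<lambda>x. \<exists>k\<in>{..m}. support_line m q n x = k \<and> order_stat m x k = x i)"
    by measurable
  then show ?thesis
    using support_line_le by (simp add: boundary_at_def[abs_def])
qed

lemma pred_boundary_at_loo [measurable]:
  assumes i: "i \<in> {1..m}"
  shows "Measurable.pred (PiM {1..m} (\<lambda>_. borel))
    (\<lambda>x. boundary_at m q (m - loo_support_line m q i x) i x)"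
proof -
  note [measurable] = pred_boundary_at[OF i] measurable_loo_support_line[OF i]
  have "Measurable.pred (PiM {1..m} (\<lambda>_. borel))
      (\<lambda>x. \<exists>k\<in>{..m}. loo_support_line m q i x = k \<and> boundary_at m q (m - k) i x)"
    by measurable
  then show ?thesis
    using support_line_le by (simp add: loo_support_line_def)
qed

section \<open>Boundary probability of one null given the other p-values\<close>

text \<open>With \<open>G\<close> counting the other p-values, \<open>x(i := t)\<close> has count
  \<open>G s\<close> for \<open>s < t\<close> and \<open>G s + 1\<close> from \<open>t\<close> on.
  For boundary positions \<open>s < t\<close>, optimality of \<open>s\<close> against
  \<open>t\<close> gives the strict decrease, and optimality of \<open>t\<close> against
  \<open>s\<close> gives the diameter bound, where the slope \<open>q / n\<close> is the
  contribution of \<open>i\<close>.\<close>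

lemma emeasure_boundary_at_le:
  assumes q: "0 \<le> q" and i: "i \<in> {1..m}"
    and meas: "{t \<in> {0<..<1}. boundary_at m q n i (x(i := t))} \<in> sets borel"
  shows "emeasure lborel {t \<in> {0<..<1}. boundary_at m q n i (x(i := t))} \<le> ennreal (q / n)"
    (is "emeasure lborel ?S \<le> _")
proof -
  define G where "G s = card {j \<in> {1..m} - {i}. x j \<le> s}" for s
  have count: "count_le m (x(i := t)) s = G s + (if t \<le> s then 1 else 0)" for s t
    using count_le_upd[OF i] by (simp add: G_def)
  have opt: "q / n * count_le m (x(i := t)) s - s \<le> q / n * count_le m (x(i := t)) t - t"
    "t < s \<Longrightarrow> q / n * count_le m (x(i := t)) s - s < q / n * count_le m (x(i := t)) t - t"
    if "t \<in> ?S" "0 \<le> s" for s t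
    using that support_point_support_line[OF q, of m n "x(i := t)"]
    by (auto simp: boundary_at_def support_point_def)
  show ?thesis
  proof (rule emeasure_record_set_le[where G = G and m = m])
    show "G \<in> measurable borel (count_space UNIV)"
    proof -
      have "(\<lambda>s. \<Sum>j\<in>{1..m} - {i}. if x j \<le> s then 1 else 0 :: nat) \<in> measurable borel (count_space UNIV)"
        by measurable
      moreover have "G = (\<lambda>s. \<Sum>j\<in>{1..m} - {i}. if x j \<le> s then 1 else 0)"
        unfolding G_def by (simp add: sum.If_cases Int_def)
      ultimately show ?thesis by (simp only:)
    qed
    show "G t \<le> m" for t
      using count_le_le[of m "x(i := t)" t] by (simp add: count)
    show "0 \<le> q / n" using q by simp
    show "q / n * G t - t < q / n * G s - s" if "s \<in> ?S" "t \<in> ?S" "s < t" for s t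
    proof -
      have "0 \<le> t" using that(2) by simp
      from opt(2)[OF that(1) this that(3)] show ?thesis
        using that(3) by (simp add: count distrib_left del: times_divide_eq_left)
    qed
    show "q / n * G s - s \<le> q / n * G t - t + q / n" if "s \<in> ?S" "t \<in> ?S" "s < t" for s t
    proof -
      have "0 \<le> s" using that(1) by simp
      from opt(1)[OF that(2) this] show ?thesis
        using that(3) by (simp add: count distrib_left del: times_divide_eq_left)
    qed
  qed (rule meas)
qed

lemma boundary_at_cong:
  assumes "\<And>j. j \<in> {1..m} \<Longrightarrow> x j = y j" and "i \<in> {1..m}"
  shows "boundary_at m q (m - loo_support_line m q i x) i x \<longleftrightarrow>
    boundary_at m q (m - loo_support_line m q i y) i y"
proof -
  have "loo_support_line m q i x = loo_support_line m q i y"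
    unfolding loo_support_line_def by (rule support_line_cong) (use assms(1) in auto)
  moreover have "support_line m q n x = support_line m q n y" for n
    by (rule support_line_cong) (rule assms(1))
  ultimately show ?thesis
    using order_stat_cong[OF assms(1), where m = m] support_line_le assms by (simp add: boundary_at_def)
qed

lemma uniform_unit_emeasure:
  assumes "A \<in> sets borel"
  shows "emeasure (uniform_measure lborel {0<..<1 :: real}) A = emeasure lborel ({0<..<1} \<inter> A)"
  using assms by (simp add: divide_ennreal_def)

section \<open>Shares among the p-values exceeding \<open>q\<close>\<close>

definition exceed_share :: "nat \<Rightarrow> real \<Rightarrow> nat \<Rightarrow> (nat \<Rightarrow> real) \<Rightarrow> ennreal" where
  "exceed_share m q i x = (if q < x i then ennreal (1 / real (m - count_le m x q)) else 0)"

lemma measurable_exceed_share [measurable]: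
  assumes "i \<in> {1..m}"
  shows "exceed_share m q i \<in> borel_measurable (PiM {1..m} (\<lambda>_. borel))"
proof -
  have [measurable]: "(\<lambda>x. x i) \<in> borel_measurable (PiM {1..m} (\<lambda>_. borel :: real measure))"
    using assms by (rule measurable_component_singleton)
  have "(\<lambda>x. ennreal (1 / real (m - count_le m x q))) \<in> borel_measurable (PiM {1..m} (\<lambda>_. borel))"
    by (rule measurable_compose[OF measurable_count_le]) simp
  moreover have "{x \<in> space (PiM {1..m} (\<lambda>_. borel :: real measure)). q < x i} \<in> sets (PiM {1..m} (\<lambda>_. borel))"
    by measurable
  ultimately show ?thesis
    unfolding exceed_share_def[abs_def] by (intro measurable_If measurable_const) simp_all
qed

text \<open>At most \<open>m - count_le m x q\<close> indices contribute, each the reciprocal of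
  this number; if it is zero, the quotient is zero as well.\<close>

lemma sum_exceed_share_le:
  assumes "N \<subseteq> {1..m}"
  shows "(\<Sum>i\<in>N. exceed_share m q i x) \<le> 1"
proof -
  have fin: "finite N" using assms by (rule finite_subset) simp
  have "card ({1..m} - {j \<in> {1..m}. x j \<le> q}) = m - count_le m x q"
    unfolding count_le_def by (subst card_Diff_subset) auto
  also have "{1..m} - {j \<in> {1..m}. x j \<le> q} = {j \<in> {1..m}. q < x j}"
    by auto
  finally have card: "card {j \<in> {1..m}. q < x j} = m - count_le m x q" .
  have le: "card {i \<in> N. q < x i} \<le> m - count_le m x q"
    unfolding card[symmetric] using assms by (intro card_mono) auto
  have "(\<Sum>i\<in>N. exceed_share m q i x) =
      (\<Sum>i\<in>N. ennreal (if q < x i then 1 / real (m - count_le m x q) else 0))"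
    by (intro sum.cong) (auto simp: exceed_share_def)
  also have "\<dots> = ennreal (\<Sum>i\<in>N. if q < x i then 1 / real (m - count_le m x q) else 0)"
    by (rule sum_ennreal) simp
  also have "(\<Sum>i\<in>N. if q < x i then 1 / real (m - count_le m x q) else 0) =
      real (card {i \<in> N. q < x i}) / real (m - count_le m x q)"
    using fin by (simp add: sum.If_cases Int_def)
  also have "ennreal \<dots> \<le> 1"
  proof -
    have "real a / real b \<le> 1" if "a \<le> b" for a b :: nat
      using that by (auto simp: divide_le_eq_1)
    from this[OF le] show ?thesis by simp
  qed
  finally show ?thesis .
qed

text \<open>Coordinate \<open>i\<close> is integrated first. With \<open>c\<close> other p-values at
  most \<open>q\<close>, the left inner integral is at most \<open>(1 - q) * q / (m - c)\<close>.
  The right one equals this, since the share is \<open>1 / (m - c)\<close> exactly when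
  \<open>p_i\<close> exceeds \<open>q\<close>.\<close>

lemma emeasure_boundary_at_loo_le:
  fixes D :: "nat \<Rightarrow> real measure"
  assumes q: "0 \<le> q" "q < 1" and i: "i \<in> {1..m}"
    and prob: "\<And>j. prob_space (D j)" and sets: "\<And>j. sets (D j) = sets borel"
    and unif: "D i = uniform_measure lborel {0<..<1}"
  shows "ennreal (1 - q) *
      emeasure (PiM {1..m} D)
        {x \<in> space (PiM {1..m} D). boundary_at m q (m - loo_support_line m q i x) i x}
    \<le> (\<integral>\<^sup>+x. ennreal q * exceed_share m q i x \<partial>PiM {1..m} D)"
    (is "_ * emeasure _ ?A \<le> _")
proof -
  interpret product_sigma_finite D
    using prob by (auto simp: product_sigma_finite_def intro: prob_space_imp_sigma_finite)
  let ?I = "{1..m} - {i}"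
  let ?P = "PiM {1..m} D"
  have sets_P: "sets ?P = sets (PiM {1..m} (\<lambda>_. borel))"
    using sets by (intro sets_PiM_cong) auto
  have ins: "insert i ?I = {1..m}" using i by auto
  have A [measurable]: "?A \<in> sets ?P"
    using pred_boundary_at_loo[OF i, of q] unfolding pred_def
    by (simp only: sets_P sets_eq_imp_space_eq[OF sets_P])
  have share [measurable]: "exceed_share m q i \<in> borel_measurable ?P"
    using measurable_exceed_share[OF i, of q] by (simp only: measurable_cong_sets[OF sets_P refl])
  have "ennreal (1 - q) * emeasure ?P ?A = (\<integral>\<^sup>+x. ennreal (1 - q) * indicator ?A x \<partial>?P)"
    by (rule nn_integral_cmult_indicator[OF A, symmetric])
  also have "\<dots> = (\<integral>\<^sup>+y. (\<integral>\<^sup>+t. ennreal (1 - q) * indicator ?A (y(i := t)) \<partial>D i) \<partial>PiM ?I D)"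
    by (rule product_nn_integral_insert[of ?I i, unfolded ins]) (simp, simp, measurable)
  also have "\<dots> \<le> (\<integral>\<^sup>+y. (\<integral>\<^sup>+t. ennreal q * exceed_share m q i (y(i := t)) \<partial>D i) \<partial>PiM ?I D)"
  proof (rule nn_integral_mono)
    fix y
    assume y: "y \<in> space (PiM ?I D)"
    have upd: "(\<lambda>t. y(i := t)) \<in> measurable (D i) ?P"
      using measurable_component_update[OF y, of i] unfolding ins by simp
    define r where "r = loo_support_line m q i y"
    define c where "c = card {j \<in> ?I. y j \<le> q}"
    have "r \<le> c"
      unfolding r_def c_def by (rule loo_support_line_le[OF q i])
    have "c < m"
    proof -
      have "c \<le> card ?I" unfolding c_def by (intro card_mono) auto
      then show ?thesis using i by auto
    qed
    let ?S = "{t. boundary_at m q (m - r) i (y(i := t))}"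
    \<comment> \<open>The leave-one-out count overwrites coordinate \<open>i\<close>, so
      \<open>r\<close> does not vary with \<open>t\<close> and the slope is fixed in the inner
      integral.\<close>
    have mem: "y(i := t) \<in> ?A \<longleftrightarrow> t \<in> ?S" for t
    proof -
      have "y(i := t) \<in> space ?P"
        using measurable_space[OF upd, of t] sets_eq_imp_space_eq[OF sets] by simp
      then show ?thesis by (simp add: r_def loo_support_line_def)
    qed
    have S: "?S \<in> sets borel"
      using measurable_sets[OF upd A] sets_eq_imp_space_eq[OF sets, of i] mem
      by (simp add: vimage_def sets)
    have "{0<..<1} \<inter> ?S = {t \<in> {0<..<1}. boundary_at m q (m - r) i (y(i := t))}"
      by auto
    then have "emeasure (D i) ?S =
        emeasure lborel {t \<in> {0<..<1}. boundary_at m q (m - r) i (y(i := t))}"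
      using uniform_unit_emeasure[OF S] by (simp only: unif)
    also have "\<dots> \<le> ennreal (q / real (m - r))"
    proof (rule emeasure_boundary_at_le[OF q(1) i])
      have "{0<..<1} \<inter> ?S \<in> sets borel" using S by auto
      then show "{t \<in> {0<..<1}. boundary_at m q (m - r) i (y(i := t))} \<in> sets borel"
        by (simp add: Int_def)
    qed
    also have "\<dots> \<le> ennreal (q / real (m - c))"
      using \<open>r \<le> c\<close> \<open>c < m\<close> q by (intro ennreal_leI divide_left_mono) auto
    finally have S_le: "emeasure (D i) ?S \<le> ennreal (q / real (m - c))" .
    have tail: "emeasure (D i) {q<..} = ennreal (1 - q)"
    proof -
      have "{0<..<1} \<inter> {q<..} = {q<..<1}" using q by auto
      then show ?thesis using uniform_unit_emeasure[of "{q<..}"] q by (simp add: unif)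
    qed
    have "(\<integral>\<^sup>+t. ennreal (1 - q) * indicator ?A (y(i := t)) \<partial>D i) =
        (\<integral>\<^sup>+t. ennreal (1 - q) * indicator ?S t \<partial>D i)"
      by (intro nn_integral_cong arg_cong2[where f = "(*)"] refl) (simp only: indicator_def mem)
    also have "\<dots> = ennreal (1 - q) * emeasure (D i) ?S"
      using S by (intro nn_integral_cmult_indicator) (simp add: sets)
    also have "\<dots> \<le> ennreal (1 - q) * ennreal (q / real (m - c))"
      by (intro mult_left_mono S_le) simp
    \<comment> \<open>From here \<open>1 - q\<close> is read as the mass that \<open>D i\<close>
      gives to values above \<open>q\<close>.\<close>
    also have "\<dots> = ennreal (q * (1 / real (m - c))) * ennreal (1 - q)"
      by (simp add: mult.commute)
    also have "\<dots> = (\<integral>\<^sup>+t. ennreal (q * (1 / real (m - c))) * indicator {q<..} t \<partial>D i)"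
      unfolding tail[symmetric] by (intro nn_integral_cmult_indicator[symmetric]) (simp add: sets)
    also have "\<dots> = (\<integral>\<^sup>+t. ennreal q * exceed_share m q i (y(i := t)) \<partial>D i)"
      using q by (intro nn_integral_cong)
        (simp add: exceed_share_def count_le_upd[OF i] c_def ennreal_mult[symmetric])
    finally show "(\<integral>\<^sup>+t. ennreal (1 - q) * indicator ?A (y(i := t)) \<partial>D i)
        \<le> (\<integral>\<^sup>+t. ennreal q * exceed_share m q i (y(i := t)) \<partial>D i)" .
  qed
  also have "\<dots> = (\<integral>\<^sup>+x. ennreal q * exceed_share m q i x \<partial>?P)"
    by (rule product_nn_integral_insert[of ?I i, unfolded ins, symmetric]) (simp, simp, measurable)
  finally show ?thesis .
qed

section \<open>Transfer to the product law and summation over the true nulls\<close>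

theorem theorem3p1:
  fixes M :: "'a measure"
    and m :: nat
    and q :: real
    and H :: "nat \<Rightarrow> bool"
    and p :: "nat \<Rightarrow> 'a \<Rightarrow> real"
  assumes "prob_space M"
    and "m \<ge> 1"
    and "0 \<le> q" and "q < 1"
    and "prob_space.indep_vars M (\<lambda>_. borel) p {1..m}"
    and "\<And>i \<omega>. i \<in> {1..m} \<Longrightarrow> \<omega> \<in> space M \<Longrightarrow> p i \<omega> \<in> {0..1}"
    and "\<And>i. i \<in> {1..m} \<Longrightarrow> H i \<Longrightarrow> distr M lborel (p i) = uniform_measure lborel {0<..<1}"
  shows "bFDR M m H p (tssl_rejections m q) =
           measure M {\<omega> \<in> space M. ordered_null m H (\<lambda>i. p i \<omega>) (tssl_R2 m q (\<lambda>i. p i \<omega>))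
                                 \<and> tssl_R2 m q (\<lambda>i. p i \<omega>) > 0}
       \<and> bFDR M m H p (tssl_rejections m q) \<le> q / (1 - q)"
proof
  interpret prob_space M by fact
  note q = \<open>0 \<le> q\<close> \<open>q < 1\<close>
  let ?E = "{\<omega> \<in> space M. ordered_null m H (\<lambda>i. p i \<omega>) (tssl_R2 m q (\<lambda>i. p i \<omega>))
                                 \<and> tssl_R2 m q (\<lambda>i. p i \<omega>) > 0}"
  show eq: "bFDR M m H p (tssl_rejections m q) = measure M ?E"
    by (simp add: bFDR_def card_tssl_rejections[OF q(1)])
  define N where "N = {i \<in> {1..m}. H i}"
  have N: "finite N" "N \<subseteq> {1..m}" by (auto simp: N_def)
  define X where "X \<omega> = (\<lambda>i\<in>{1..m}. p i \<omega>)" for \<omega>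
  have p: "p i \<in> borel_measurable M" if "i \<in> {1..m}" for i
    using assms(5) that unfolding indep_vars_def by blast
  have X: "X \<in> measurable M (PiM {1..m} (\<lambda>_. borel))"
    unfolding X_def by (intro measurable_restrict p)
  \<comment> \<open>The point mass outside \<open>{1..m}\<close> makes every \<open>D i\<close> a
    probability measure, as the product lemmas demand of the whole family.\<close>
  define D where "D i = (if i \<in> {1..m} then distr M borel (p i) else return borel 0)" for i
  have prob_D: "prob_space (D i)" for i
    using p by (auto simp: D_def intro!: prob_space_distr prob_space_return)
  have sets_D: "sets (D i) = sets borel" for i
    by (simp add: D_def)
  have unif_D: "D i = uniform_measure lborel {0<..<1}" if "i \<in> N" for i
  proof -
    have "D i = distr M borel (p i)" using that by (simp add: D_def N_def)
    also have "\<dots> = distr M lborel (p i)" by (intro distr_cong) auto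
    also have "\<dots> = uniform_measure lborel {0<..<1}" using that by (intro assms(7)) (auto simp: N_def)
    finally show ?thesis .
  qed
  let ?P = "PiM {1..m} D"
  interpret P: prob_space ?P
    by (intro prob_space_PiM prob_D)
  have distr_X: "distr M (PiM {1..m} (\<lambda>_. borel)) X = ?P"
  proof -
    have "distr M (PiM {1..m} (\<lambda>_. borel)) X = PiM {1..m} (\<lambda>i. distr M borel (p i))"
      unfolding X_def[abs_def]
      using assms(2,5) p by (intro indep_vars_iff_distr_eq_PiM'[THEN iffD1]) auto
    also have "\<dots> = ?P" by (intro PiM_cong) (auto simp: D_def)
    finally show ?thesis .
  qed
  have sets_P: "sets ?P = sets (PiM {1..m} (\<lambda>_. borel))"
    by (intro sets_PiM_cong refl sets_D)
  define A where "A i = {x \<in> space ?P. boundary_at m q (m - loo_support_line m q i x) i x}" for i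
  have A: "A i \<in> sets (PiM {1..m} (\<lambda>_. borel))" if "i \<in> N" for i
    using pred_boundary_at_loo[of i m q] that N(2) unfolding pred_def A_def
    by (auto simp only: sets_eq_imp_space_eq[OF sets_P])
  \<comment> \<open>A measurable superset of \<open>?E\<close>; bounding it bypasses the
    measurability of \<open>order_index\<close>.\<close>
  define B where "B = (\<Union>i\<in>N. X -` A i \<inter> space M)"
  have B: "B \<in> sets M"
    unfolding B_def using N(1) A X by (intro sets.finite_UN measurable_sets) auto
  have "?E \<subseteq> B"
  proof
    fix \<omega>
    assume \<omega>: "\<omega> \<in> ?E"
    let ?x = "\<lambda>i. p i \<omega>"
    define i where "i = order_index m ?x (tssl_R2 m q ?x)"
    have i: "i \<in> N"
      using \<omega> order_index_in[of "tssl_R2 m q ?x" m ?x] tssl_R2_le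
      by (auto simp: i_def N_def ordered_null_def)
    have "boundary_at m q (m - loo_support_line m q i ?x) i ?x"
      using \<omega> assms(6) by (intro tssl_boundary[OF q _ _ i_def]) auto
    then have "boundary_at m q (m - loo_support_line m q i (X \<omega>)) i (X \<omega>)"
      using i N(2) by (subst boundary_at_cong[where y = ?x]) (auto simp: X_def)
    moreover have "X \<omega> \<in> space ?P"
      using \<omega> measurable_space[OF X] sets_eq_imp_space_eq[OF sets_P] by auto
    ultimately show "\<omega> \<in> B"
      using \<omega> i by (auto simp: B_def A_def)
  qed
  then have "measure M ?E \<le> measure M B"
    by (rule finite_measure_mono) (rule B)
  have share: "exceed_share m q i \<in> borel_measurable ?P" if "i \<in> N" for i
    using measurable_exceed_share[of i m q] that N(2)
    by (auto simp only: measurable_cong_sets[OF sets_P refl])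
  have "ennreal (1 - q) * emeasure M B \<le> ennreal (1 - q) * (\<Sum>i\<in>N. emeasure M (X -` A i \<inter> space M))"
    unfolding B_def using N(1) A X
    by (intro mult_left_mono emeasure_subadditive_finite) (auto intro: measurable_sets)
  also have "\<dots> = (\<Sum>i\<in>N. ennreal (1 - q) * emeasure ?P (A i))"
    unfolding sum_distrib_left using A X
    by (intro sum.cong refl) (simp only: distr_X[symmetric] emeasure_distr)
  also have "\<dots> \<le> (\<Sum>i\<in>N. \<integral>\<^sup>+x. ennreal q * exceed_share m q i x \<partial>?P)"
    unfolding A_def using N(2)
    by (intro sum_mono emeasure_boundary_at_loo_le q prob_D sets_D unif_D) auto
  also have "\<dots> = (\<integral>\<^sup>+x. ennreal q * (\<Sum>i\<in>N. exceed_share m q i x) \<partial>?P)"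
    unfolding sum_distrib_left using share by (intro nn_integral_sum[symmetric]) auto
  also have "\<dots> \<le> (\<integral>\<^sup>+x. ennreal q * 1 \<partial>?P)"
    by (intro nn_integral_mono mult_left_mono sum_exceed_share_le N) simp
  also have "\<dots> = ennreal q"
    by (simp add: P.emeasure_space_1 del: One_nat_def)
  finally have "(1 - q) * measure M B \<le> q"
    using q by (simp add: emeasure_eq_measure ennreal_mult[symmetric])
  then have "measure M B \<le> q / (1 - q)"
    using q by (simp add: le_divide_eq mult.commute)
  with \<open>measure M ?E \<le> measure M B\<close> show "bFDR M m H p (tssl_rejections m q) \<le> q / (1 - q)"
    unfolding eq by simp
qed

end
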